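(* Assume the continuum hypothesis. Then there is a non-P-point $\mathcal W$ in standard position on $\omega^2$ that has the three-functions property but is not $(2,4)$-weakly Ramsey.
   Context: Ultrafilters are nonprincipal. $\pi_1:\omega^2\to\omega$ is the first projection. A non-P-point in standard position is an ultrafilter $\mathcal W$ on $\omega^2$ such that $\pi_1$ is neither finite-to-one nor constant on any set in $\mathcal W$. $\mathcal W$ has the three-functions property if for every function $f$ on $\omega^2$ there is $H\in\mathcal W$ such that $f\restriction H$ is constant, or one-to-one, or equal to $g\circ\pi_1\restriction H$ for a one-to-one $g$ on $\omega$. $\mathcal W$ is $(n,t)$-weakly Ramsey if whenever $[\omega^2]^n$ is partitioned into finitely many pieces there is $H\in\mathcal W$ with $[H]^n$ meeting at most $t$ pieces. *)

theory Defs
  imports Main "HOL-Library.Countable_Set"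
begin

definition CH :: bool where
  "CH \<longleftrightarrow> (\<forall>A :: nat set set. countable A \<or> (\<exists>f. bij_betw f A (UNIV :: nat set set)))"

definition ultrafilter_on_sq :: "(nat \<times> nat) set set \<Rightarrow> bool" where
  "ultrafilter_on_sq U \<longleftrightarrow>
     UNIV \<in> U \<and> {} \<notin> U \<and>
     (\<forall>A B. A \<in> U \<longrightarrow> A \<subseteq> B \<longrightarrow> B \<in> U) \<and>
     (\<forall>A B. A \<in> U \<longrightarrow> B \<in> U \<longrightarrow> A \<inter> B \<in> U) \<and>
     (\<forall>A. A \<in> U \<or> - A \<in> U)"

definition nonprincipal :: "(nat \<times> nat) set set \<Rightarrow> bool" where
  "nonprincipal U \<longleftrightarrow> (\<forall>A\<in>U. infinite A)"

definition non_P_point_standard :: "(nat \<times> nat) set set \<Rightarrow> bool" where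
  "non_P_point_standard W \<longleftrightarrow>
     ultrafilter_on_sq W \<and> nonprincipal W \<and>
     (\<forall>H\<in>W. \<not> (\<forall>n. finite {x\<in>H. fst x = n}) \<and> \<not> (\<exists>n. \<forall>x\<in>H. fst x = n))"

definition three_functions_property :: "(nat \<times> nat) set set \<Rightarrow> bool" where
  "three_functions_property W \<longleftrightarrow>
     (\<forall>f :: nat \<times> nat \<Rightarrow> nat. \<exists>H\<in>W.
        (\<exists>c. \<forall>x\<in>H. f x = c) \<or> inj_on f H \<or>
        (\<exists>g :: nat \<Rightarrow> nat. inj g \<and> (\<forall>x\<in>H. f x = g (fst x))))"

definition weakly_Ramsey :: "nat \<Rightarrow> nat \<Rightarrow> (nat \<times> nat) set set \<Rightarrow> bool" where
  "weakly_Ramsey n t W \<longleftrightarrow>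
     (\<forall>(k::nat) (c :: (nat \<times> nat) set \<Rightarrow> nat).
        (\<forall>s. finite s \<and> card s = n \<longrightarrow> c s < k) \<longrightarrow>
        (\<exists>H\<in>W. card (c ` {s. s \<subseteq> H \<and> finite s \<and> card s = n}) \<le> t))"

end

theory Submission
  imports Defs
begin

text \<open>Read every column of the plane as the tree of finite sequences of naturals, and call a set
  positive if infinitely many of its columns are somewhere dense in that tree. On a somewhere dense
  set, a function either has a somewhere dense fibre or is injective on a dense part of the set;
  hence every positive set has a positive subset on which a given function is constant, injective,
  or an injective function of the column. Countable chains of positive sets, ordered by inclusion
  modulo finitely many columns, have positive lower bounds, so under CH a tower of length
  \<open>\<omega>\<^sub>1\<close> meets the requirement of every function; applied to characteristic functions, this
  already makes the generated filter an ultrafilter. Every positive set contains both comparable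
  and incomparable pairs within a column, and three order types of pairs across columns, so five
  colours are unavoidable.\<close>

section \<open>Somewhere dense sets in the tree of finite sequences\<close>

text \<open>The negation is nowhere density in the topology on finite sequences whose basic open
  sets are the cones of all extensions of a node; \<open>s\<close> is the root of a cone in which
  the set is dense. Sequences are identified with naturals through the bijection
  \<open>list_encode\<close>.\<close>

definition somewhere_dense :: "nat set \<Rightarrow> bool" where
  "somewhere_dense S \<longleftrightarrow> (\<exists>s. \<forall>t. \<exists>u. list_encode (s @ t @ u) \<in> S)"

lemma somewhere_dense_mono: "somewhere_dense S \<Longrightarrow> S \<subseteq> T \<Longrightarrow> somewhere_dense T"
  unfolding somewhere_dense_def by blast

lemma somewhere_dense_UNIV: "somewhere_dense UNIV"
  unfolding somewhere_dense_def by blast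

text \<open>If \<open>B\<close> is nowhere dense, it misses a cone above some \<open>s @ t\<close>;
  inside that cone all witnesses of density come from \<open>A\<close>. This makes the nowhere dense
  sets an ideal.\<close>

lemma somewhere_dense_Un:
  assumes "somewhere_dense (A \<union> B)"
  shows "somewhere_dense A \<or> somewhere_dense B"
proof (rule disjCI)
  assume nB: "\<not> somewhere_dense B"
  from assms obtain s where s: "\<And>t. \<exists>u. list_encode (s @ t @ u) \<in> A \<union> B"
    unfolding somewhere_dense_def by blast
  from nB obtain t where t: "\<And>u. list_encode (s @ t @ u) \<notin> B"
    unfolding somewhere_dense_def by blast
  have "\<exists>u. list_encode ((s @ t) @ t' @ u) \<in> A" for t'
    using s[of "t @ t'"] t[of "t' @ _"] by auto
  then show "somewhere_dense A"
    unfolding somewhere_dense_def by blast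
qed

lemma somewhere_dense_UN:
  assumes "finite F" "somewhere_dense (\<Union>c\<in>F. T c)"
  shows "\<exists>c\<in>F. somewhere_dense (T c)"
  using assms
proof (induction F rule: finite_induct)
  case empty
  then show ?case by (simp add: somewhere_dense_def)
next
  case (insert c F)
  then show ?case using somewhere_dense_Un[of "T c" "\<Union>c\<in>F. T c"] by auto
qed

text \<open>Density in a cone yields arbitrarily long sequences, whereas finitely many codes have
  bounded length.\<close>

lemma somewhere_dense_infinite:
  assumes "somewhere_dense S"
  shows "infinite S"
proof
  assume "finite S"
  then obtain k where k: "\<And>m. m \<in> S \<Longrightarrow> length (list_decode m) \<le> k"
    using finite_nat_set_iff_bounded_le[of "(length \<circ> list_decode) ` S"] by auto
  obtain s where s: "\<And>t. \<exists>u. list_encode (s @ t @ u) \<in> S"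
    using assms unfolding somewhere_dense_def by blast
  obtain u where "list_encode (s @ replicate (Suc k) 0 @ u) \<in> S"
    using s by blast
  from k[OF this] show False by simp
qed

text \<open>If every point of \<open>S\<close> above \<open>s @ t\<close> had its value in
  \<open>F\<close>, finitely many fibres would cover a set dense above \<open>s @ t\<close>, and one
  of them would be somewhere dense.\<close>

lemma somewhere_dense_avoid:
  assumes dense: "\<And>t. \<exists>u. list_encode (s @ t @ u) \<in> S"
    and fibres: "\<And>c. \<not> somewhere_dense {m\<in>S. h m = c}"
    and "finite F"
  shows "\<exists>u. list_encode (s @ t @ u) \<in> S \<and> h (list_encode (s @ t @ u)) \<notin> F"
proof (rule ccontr)
  assume neg: "\<not> ?thesis"
  have "\<exists>u. list_encode ((s @ t) @ t' @ u) \<in> (\<Union>c\<in>F. {m\<in>S. h m = c})" for t'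
  proof -
    obtain u where "list_encode (s @ (t @ t') @ u) \<in> S" using dense by blast
    then show ?thesis using neg by auto
  qed
  then have "somewhere_dense (\<Union>c\<in>F. {m\<in>S. h m = c})"
    unfolding somewhere_dense_def by blast
  then show False using somewhere_dense_UN[OF \<open>finite F\<close>] fibres by blast
qed

section \<open>Positive sets and inclusion modulo finitely many columns\<close>

text \<open>These are the sets outside the Fubini product of the ideal of finite sets with the ideal
  of nowhere dense sets.\<close>

definition positive :: "(nat \<times> nat) set \<Rightarrow> bool" where
  "positive A \<longleftrightarrow> infinite {n. somewhere_dense (A `` {n})}"

definition almost_subset :: "(nat \<times> nat) set \<Rightarrow> (nat \<times> nat) set \<Rightarrow> bool"  (infix "\<subseteq>\<^sup>*" 50) where
  "A \<subseteq>\<^sup>* B \<longleftrightarrow> finite (fst ` (A - B))"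

lemma subset_imp_almost: "A \<subseteq> B \<Longrightarrow> A \<subseteq>\<^sup>* B"
  unfolding almost_subset_def by (simp add: Diff_eq_empty_iff[THEN iffD2])

lemma almost_trans: "A \<subseteq>\<^sup>* B \<Longrightarrow> B \<subseteq>\<^sup>* C \<Longrightarrow> A \<subseteq>\<^sup>* C"
  unfolding almost_subset_def
  by (rule finite_subset[of _ "fst ` (A - B) \<union> fst ` (B - C)"]) auto

lemma almost_Int: "A \<subseteq>\<^sup>* B \<Longrightarrow> A \<subseteq>\<^sup>* C \<Longrightarrow> A \<subseteq>\<^sup>* B \<inter> C"
  unfolding almost_subset_def by (simp add: Diff_Int image_Un)

lemma positive_almost:
  assumes "positive A" "A \<subseteq>\<^sup>* B"
  shows "positive B"
proof -
  have "{n. somewhere_dense (A `` {n})} \<subseteq> {n. somewhere_dense (B `` {n})} \<union> fst ` (A - B)"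
  proof
    fix n assume n: "n \<in> {n. somewhere_dense (A `` {n})}"
    show "n \<in> {n. somewhere_dense (B `` {n})} \<union> fst ` (A - B)"
    proof (cases "A `` {n} \<subseteq> B `` {n}")
      case True
      then show ?thesis using n somewhere_dense_mono by blast
    next
      case False
      then show ?thesis by force
    qed
  qed
  with assms show ?thesis
    unfolding positive_def almost_subset_def by (meson finite_Un finite_subset)
qed

lemma positive_UNIV: "positive UNIV"
  unfolding positive_def using somewhere_dense_UNIV by (simp add: Image_singleton)

text \<open>A diagonal argument: enumerate the family, form the decreasing finite intersections
  \<open>b k\<close>, and take a single somewhere dense column from each, in strictly increasing
  positions \<open>N k\<close>.\<close>

lemma pseudointersection:
  assumes "countable \<A>"
    and pos: "\<And>A. A \<in> \<A> \<Longrightarrow> positive A"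
    and chain: "\<And>A B. A \<in> \<A> \<Longrightarrow> B \<in> \<A> \<Longrightarrow> A \<subseteq>\<^sup>* B \<or> B \<subseteq>\<^sup>* A"
  shows "\<exists>D. positive D \<and> (\<forall>A\<in>\<A>. D \<subseteq>\<^sup>* A)"
proof (cases "\<A> = {}")
  case True
  then show ?thesis using positive_UNIV by blast
next
  case False
  define a where "a = from_nat_into \<A>"
  have a: "a k \<in> \<A>" for k using False by (simp add: a_def from_nat_into)
  have range_a: "\<exists>k. A = a k" if "A \<in> \<A>" for A
    using that assms(1) by (metis a_def from_nat_into_surj)
  define b where "b k = (\<Inter>i\<le>k. a i)" for k
  \<comment> \<open>Linearity of the chain enters here: of the member found for \<open>b k\<close>
    and the next set \<open>a (Suc k)\<close>, the almost smaller one lies almost below both. Hence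
    each \<open>b k\<close> is positive.\<close>
  have "\<exists>A\<in>\<A>. A \<subseteq>\<^sup>* b k" for k
  proof (induction k)
    case 0
    show ?case using a[of 0] subset_imp_almost[of "a 0" "a 0"] by (auto simp: b_def)
  next
    case (Suc k)
    then obtain A where A: "A \<in> \<A>" "A \<subseteq>\<^sup>* b k" by blast
    have eq: "b (Suc k) = b k \<inter> a (Suc k)" by (auto simp: b_def atMost_Suc)
    show ?case
      using chain[OF A(1) a[of "Suc k"]]
    proof
      assume "A \<subseteq>\<^sup>* a (Suc k)"
      then show ?thesis using A almost_Int eq by auto
    next
      assume "a (Suc k) \<subseteq>\<^sup>* A"
      then have "a (Suc k) \<subseteq>\<^sup>* b (Suc k)"
        using A almost_trans almost_Int eq subset_imp_almost by (metis order_refl)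
      then show ?thesis using a by blast
    qed
  qed
  then have posb: "positive (b k)" for k using pos positive_almost by blast
  have "\<exists>N. \<forall>k. somewhere_dense (b k `` {N k}) \<and> N k < N (Suc k)"
  proof (rule dependent_nat_choice)
    show "\<exists>n. somewhere_dense (b 0 `` {n})"
      using posb[of 0] unfolding positive_def using not_finite_existsD by blast
  next
    fix n k
    show "\<exists>m. somewhere_dense (b (Suc k) `` {m}) \<and> n < m"
      using posb[of "Suc k"] unfolding positive_def infinite_nat_iff_unbounded by blast
  qed
  then obtain N where N: "\<And>k. somewhere_dense (b k `` {N k})" and "\<And>k. N k < N (Suc k)"
    by blast
  then have mono: "strict_mono N" by (simp add: strict_mono_Suc_iff)
  \<comment> \<open>For \<open>i \<le> k\<close> the set \<open>b k\<close> is contained in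
    \<open>a i\<close>, so only the columns \<open>N k\<close> with \<open>k < i\<close> can leave
    \<open>a i\<close>.\<close>
  define D where "D = (\<Union>k. {N k} \<times> b k `` {N k})"
  have "range N \<subseteq> {n. somewhere_dense (D `` {n})}"
  proof clarify
    fix k
    have "b k `` {N k} \<subseteq> D `` {N k}" by (auto simp: D_def)
    then show "somewhere_dense (D `` {N k})" using N somewhere_dense_mono by blast
  qed
  then have "positive D"
    unfolding positive_def
    using mono strict_mono_imp_inj_on range_inj_infinite infinite_super by metis
  moreover have "D \<subseteq>\<^sup>* a i" for i
  proof -
    have "fst ` (D - a i) \<subseteq> N ` {..<i}"
      by (force simp: D_def b_def not_less)
    then show ?thesis unfolding almost_subset_def by (meson finite_imageI finite_lessThan finite_subset)
  qed
  ultimately show ?thesis using range_a by blast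
qed

section \<open>Canonical behaviour of a function on a positive subset\<close>

text \<open>Recursion along an enumeration of the index type: only finitely many indices precede
  \<open>i\<close>, so the values already taken form a finite set that the next choice can
  avoid.\<close>

lemma choose_distinct_values:
  fixes Q :: "'i::countable \<Rightarrow> 'a \<Rightarrow> bool" and f :: "'a \<Rightarrow> 'b"
  assumes ex: "\<And>i F. i \<in> I \<Longrightarrow> finite F \<Longrightarrow> \<exists>x. Q i x \<and> f x \<notin> F"
  shows "\<exists>u. (\<forall>i\<in>I. Q i (u i)) \<and> inj_on (f \<circ> u) I"
proof -
  let ?R = "measure (to_nat :: 'i \<Rightarrow> nat)"
  have "\<exists>u. \<forall>i. i \<in> I \<longrightarrow> Q i (u i) \<and> f (u i) \<notin> (f \<circ> u) ` {j. (j, i) \<in> ?R}"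
  proof (rule dependent_wf_choice[of ?R])
    show "wf ?R" by simp
  next
    fix u v :: "'i \<Rightarrow> 'a" and i :: 'i and r
    assume "\<And>j. (j, i) \<in> ?R \<Longrightarrow> u j = v j"
    then have "(f \<circ> u) ` {j. (j, i) \<in> ?R} = (f \<circ> v) ` {j. (j, i) \<in> ?R}"
      by (intro image_cong) auto
    then show "(i \<in> I \<longrightarrow> Q i r \<and> f r \<notin> (f \<circ> u) ` {j. (j, i) \<in> ?R}) =
      (i \<in> I \<longrightarrow> Q i r \<and> f r \<notin> (f \<circ> v) ` {j. (j, i) \<in> ?R})" by simp
  next
    fix i :: 'i and u :: "'i \<Rightarrow> 'a"
    have "finite (to_nat -` {..<to_nat i} :: 'i set)"
      by (rule finite_vimageI) auto
    then have "finite {j. (j, i) \<in> ?R}"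
      by (rule finite_subset[rotated]) auto
    then show "\<exists>r. i \<in> I \<longrightarrow> Q i r \<and> f r \<notin> (f \<circ> u) ` {j. (j, i) \<in> ?R}"
      using ex[of i "(f \<circ> u) ` {j. (j, i) \<in> ?R}"] by blast
  qed
  then obtain u where u: "\<And>i. i \<in> I \<Longrightarrow> Q i (u i)"
      "\<And>i. i \<in> I \<Longrightarrow> f (u i) \<notin> (f \<circ> u) ` {j. (j, i) \<in> ?R}" by blast
  have "inj_on (f \<circ> u) I"
  proof (rule inj_onI)
    fix i j assume "i \<in> I" "j \<in> I" "(f \<circ> u) i = (f \<circ> u) j"
    then have "(i, j) \<notin> ?R" "(j, i) \<notin> ?R"
      using u(2)[of i] u(2)[of j] by (metis (no_types, lifting) comp_apply imageI mem_Collect_eq)+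
    then have "to_nat i = to_nat j" by simp
    then show "i = j" by simp
  qed
  with u(1) show ?thesis by blast
qed

definition canonical_on :: "(nat \<times> nat) set \<Rightarrow> (nat \<times> nat \<Rightarrow> nat) \<Rightarrow> bool" where
  "canonical_on H f \<longleftrightarrow> (\<exists>c. \<forall>x\<in>H. f x = c) \<or> inj_on f H \<or>
     (\<exists>g :: nat \<Rightarrow> nat. inj g \<and> (\<forall>x\<in>H. f x = g (fst x)))"

text \<open>Let \<open>v n\<close> be the value of a somewhere dense fibre in column
  \<open>n\<close>. If \<open>v\<close> takes one value infinitely often, the corresponding fibre of
  \<open>f\<close> is positive; otherwise \<open>v\<close> is injective on an infinite set of
  columns, and there \<open>f\<close> can be made to depend on the column alone.\<close>

lemma positive_canonical_columns:
  assumes inf: "infinite {n. \<exists>c. somewhere_dense {m \<in> A `` {n}. f (n, m) = c}}"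
  shows "\<exists>B\<subseteq>A. positive B \<and> canonical_on B f"
proof -
  define N where "N = {n. \<exists>c. somewhere_dense {m \<in> A `` {n}. f (n, m) = c}}"
  have "\<forall>n\<in>N. \<exists>c. somewhere_dense {m \<in> A `` {n}. f (n, m) = c}" by (simp add: N_def)
  then obtain v where v: "\<And>n. n \<in> N \<Longrightarrow> somewhere_dense {m \<in> A `` {n}. f (n, m) = v n}"
    using bchoice[of N "\<lambda>n c. somewhere_dense {m \<in> A `` {n}. f (n, m) = c}"] by blast
  show ?thesis
  proof (cases "\<exists>c. infinite {n\<in>N. v n = c}")
    case True
    then obtain c where c: "infinite {n\<in>N. v n = c}" by blast
    define B where "B = {x\<in>A. f x = c}"
    have "{n\<in>N. v n = c} \<subseteq> {n. somewhere_dense (B `` {n})}"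
      using v by (auto simp: B_def intro: somewhere_dense_mono)
    then have "positive B" unfolding positive_def using c infinite_super by blast
    moreover have "canonical_on B f" by (auto simp: canonical_on_def B_def)
    moreover have "B \<subseteq> A" by (auto simp: B_def)
    ultimately show ?thesis by blast
  next
    case False
    \<comment> \<open>All fibres of \<open>v\<close> on the infinite set \<open>N\<close> are
      finite, so finitely many of them cannot exhaust \<open>N\<close>; this permits choosing
      columns with pairwise distinct values.\<close>
    have "\<exists>n. n \<in> N \<and> v n \<notin> F" if "finite F" for F
    proof (rule ccontr)
      assume "\<not> ?thesis"
      then have "N \<subseteq> (\<Union>c\<in>F. {n\<in>N. v n = c})" by blast
      moreover have "finite (\<Union>c\<in>F. {n\<in>N. v n = c})" using that False by auto
      ultimately show False using inf N_def finite_subset by blast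
    qed
    then have "\<exists>u::nat \<Rightarrow> nat. (\<forall>i\<in>UNIV. u i \<in> N) \<and> inj_on (v \<circ> u) UNIV"
      by (intro choose_distinct_values) auto
    then obtain u :: "nat \<Rightarrow> nat" where u: "\<And>i. u i \<in> N" and inj: "inj (v \<circ> u)" by auto
    define M where "M = range (\<lambda>i. u (2 * i))"
    \<comment> \<open>Only the even-indexed columns are kept; the values on the odd-indexed ones
      are used to extend v to an injection on all of the naturals.\<close>
    define g where "g n = (if n \<in> M then v n else v (u (2 * n + 1)))" for n
    have u_eq: "v (u i) = v (u j) \<longleftrightarrow> i = j" for i j
      using inj by (auto simp: inj_def)
    have "inj g"
    proof (rule injI)
      fix x y assume "g x = g y"
      then show "x = y"
        by (auto simp: g_def M_def u_eq split: if_splits) presburger+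
    qed
    define B where "B = {x\<in>A. fst x \<in> M \<and> f x = v (fst x)}"
    have "M \<subseteq> {n. somewhere_dense (B `` {n})}"
    proof
      fix n assume "n \<in> M"
      then have "{m \<in> A `` {n}. f (n, m) = v n} \<subseteq> B `` {n}" "n \<in> N"
        using u by (auto simp: B_def M_def)
      then show "n \<in> {n. somewhere_dense (B `` {n})}"
        using v somewhere_dense_mono by blast
    qed
    moreover have "infinite M"
      unfolding M_def by (rule range_inj_infinite) (metis (no_types, lifting) injI mult_left_cancel u_eq zero_neq_numeral)
    ultimately have "positive B" unfolding positive_def using infinite_super by blast
    moreover have "canonical_on B f"
      unfolding canonical_on_def using \<open>inj g\<close> by (intro disjI2 exI[of _ g]) (auto simp: B_def g_def)
    moreover have "B \<subseteq> A" by (auto simp: B_def)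
    ultimately show ?thesis by blast
  qed
qed

text \<open>In the remaining case, discard the finitely many columns with a somewhere dense fibre.
  In the others every cone of density offers infinitely many values, so one point per cone can be
  chosen with all values distinct, across all columns at once.\<close>

lemma positive_canonical:
  assumes "positive A"
  shows "\<exists>B\<subseteq>A. positive B \<and> canonical_on B f"
proof (cases "finite {n. \<exists>c. somewhere_dense {m \<in> A `` {n}. f (n, m) = c}}")
  case False
  then show ?thesis by (rule positive_canonical_columns)
next
  case True
  define N where "N = {n. somewhere_dense (A `` {n})} -
    {n. \<exists>c. somewhere_dense {m \<in> A `` {n}. f (n, m) = c}}"
  have infN: "infinite N"
    using assms True unfolding positive_def N_def by (rule Diff_infinite_finite[rotated])
  have "\<forall>n\<in>N. \<exists>s. \<forall>t. \<exists>u. list_encode (s @ t @ u) \<in> A `` {n}"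
    by (auto simp: N_def somewhere_dense_def)
  then obtain s where s: "\<And>n t. n \<in> N \<Longrightarrow> \<exists>u. list_encode (s n @ t @ u) \<in> A `` {n}"
    by metis
  \<comment> \<open>The index \<open>(n, t)\<close> asks for a point of \<open>A\<close> in column
    \<open>n\<close> above \<open>s n @ t\<close>. Meeting all these requests keeps column
    \<open>n\<close> dense above \<open>s n\<close>.\<close>
  define Q where "Q = (\<lambda>(n, t) x. x \<in> A \<and> (\<exists>u. x = (n, list_encode (s n @ t @ u))))"
  have "\<exists>x. Q i x \<and> f x \<notin> F" if "i \<in> N \<times> UNIV" "finite F" for i F
  proof -
    obtain n t where i: "i = (n, t)" "n \<in> N" using \<open>i \<in> N \<times> UNIV\<close> by auto
    have "\<not> somewhere_dense {m \<in> A `` {n}. f (n, m) = c}" for c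
      using i(2) by (simp add: N_def)
    from somewhere_dense_avoid[OF s[OF i(2)] this \<open>finite F\<close>, of t]
    show ?thesis by (auto simp: Q_def i(1))
  qed
  then obtain p where p: "\<forall>i\<in>N \<times> UNIV. Q i (p i)" "inj_on (f \<circ> p) (N \<times> UNIV)"
    using choose_distinct_values[of "N \<times> UNIV" Q f] by blast
  define B where "B = p ` (N \<times> UNIV)"
  have "N \<subseteq> {n. somewhere_dense (B `` {n})}"
  proof
    fix n assume n: "n \<in> N"
    have "\<exists>u. list_encode (s n @ t @ u) \<in> B `` {n}" for t
    proof -
      have "Q (n, t) (p (n, t))" using p(1) n by blast
      then obtain u where "p (n, t) = (n, list_encode (s n @ t @ u))" by (auto simp: Q_def)
      then show ?thesis using n by (auto simp: B_def intro!: exI[of _ u] image_eqI[of _ p "(n, t)"])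
    qed
    then show "n \<in> {n. somewhere_dense (B `` {n})}" unfolding somewhere_dense_def by blast
  qed
  then have "positive B" unfolding positive_def using infN infinite_super by blast
  moreover have "B \<subseteq> A" using p(1) by (auto simp: B_def Q_def)
  moreover have "canonical_on B f"
    unfolding canonical_on_def B_def using p(2) by (blast intro: inj_on_imageI)
  ultimately show ?thesis by blast
qed

section \<open>The tower of positive sets under the continuum hypothesis\<close>

text \<open>This orders the stages of the recursion so that each has only countably many
  predecessors. The well-order \<open>card_of\<close> has initial segments of smaller cardinality
  than the whole; under CH an uncountable one would have as many elements as there are sets of
  naturals, hence at least as many as there are functions.\<close>

lemma CH_wellorder_functions:
  includes cardinal_syntax
  assumes CH
  shows "\<exists>r :: ((nat \<times> nat \<Rightarrow> nat) \<times> (nat \<times> nat \<Rightarrow> nat)) set.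
    wf r \<and> (\<forall>f g. f = g \<or> (f, g) \<in> r \<or> (g, f) \<in> r) \<and> trans r \<and> (\<forall>f. countable {g. (g, f) \<in> r})"
proof -
  let ?U = "UNIV :: (nat \<times> nat \<Rightarrow> nat) set"
  let ?r = "card_of ?U"
  \<comment> \<open>A function is coded by its graph, turned into a set of naturals by
    pairing.\<close>
  define \<phi> :: "(nat \<times> nat \<Rightarrow> nat) \<Rightarrow> nat set"
    where "\<phi> f = range (\<lambda>x. prod_encode (prod_encode x, f x))" for f
  have inj: "inj \<phi>"
  proof (rule injI, rule ext)
    fix f g x assume "\<phi> f = \<phi> g"
    then have "prod_encode (prod_encode x, f x) \<in> \<phi> g" by (auto simp: \<phi>_def)
    then show "f x = g x" by (auto simp: \<phi>_def)
  qed
  have wo: "Well_order ?r" by (rule card_of_Well_order)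
  then have lin: "Linear_order ?r" and "wf (?r - Id)" by (auto simp: well_order_on_def)
  have field: "Field ?r = ?U" by (rule Field_card_of)
  have "countable (underS ?r f)" for f
  proof (rule ccontr)
    assume unc: "\<not> countable (underS ?r f)"
    have "\<not> countable (\<phi> ` underS ?r f)"
      using unc countable_image_inj_on inj inj_on_subset by blast
    then obtain h where "bij_betw h (\<phi> ` underS ?r f) (UNIV :: nat set set)"
      using assms unfolding CH_def by blast
    then have "|UNIV :: nat set set| =o |\<phi> ` underS ?r f|"
      using card_of_ordIsoI ordIso_symmetric by blast
    moreover have "|\<phi> ` underS ?r f| \<le>o |underS ?r f|" by (rule card_of_image)
    moreover have "|?U| \<le>o |UNIV :: nat set set|" using inj card_of_ordLeq by blast
    ultimately have "|?U| \<le>o |underS ?r f|"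
      using ordLeq_ordIso_trans ordLeq_transitive by blast
    moreover have "|underS ?r f| <o ?r"
      by (rule card_of_underS[OF card_of_Card_order]) (simp add: field)
    ultimately show False using not_ordLess_ordLeq by blast
  qed
  then have "countable {g. (g, f) \<in> ?r - Id}" for f
    by (simp add: underS_def conj_commute)
  moreover have "trans (?r - Id)"
    using lin unfolding order_on_defs by (simp add: trans_diff_Id)
  moreover have "f = g \<or> (f, g) \<in> ?r - Id \<or> (g, f) \<in> ?r - Id" for f g
    using lin field unfolding order_on_defs total_on_def by auto
  ultimately show ?thesis using \<open>wf (?r - Id)\<close> by blast
qed

text \<open>Stage \<open>f\<close> takes a positive lower bound of the countably many earlier sets
  and then shrinks it to a positive set on which \<open>f\<close> itself is canonical.\<close>

lemma CH_tower:
  assumes CH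
  shows "\<exists>A :: (nat \<times> nat \<Rightarrow> nat) \<Rightarrow> (nat \<times> nat) set.
    (\<forall>f. positive (A f) \<and> canonical_on (A f) f) \<and> (\<forall>f g. A f \<subseteq>\<^sup>* A g \<or> A g \<subseteq>\<^sup>* A f)"
proof -
  obtain r :: "((nat \<times> nat \<Rightarrow> nat) \<times> (nat \<times> nat \<Rightarrow> nat)) set"
    where wf: "wf r" and tot: "\<And>f g. f = g \<or> (f, g) \<in> r \<or> (g, f) \<in> r" and "trans r"
      and count: "\<And>f. countable {g. (g, f) \<in> r}"
    using CH_wellorder_functions[OF assms] by blast
  have "\<exists>A. \<forall>f. (positive (A f) \<and> canonical_on (A f) f) \<and> (\<forall>g. (g, f) \<in> r \<longrightarrow> A f \<subseteq>\<^sup>* A g)"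
  proof (rule dependent_wf_choice[OF wf])
    fix f and A :: "(nat \<times> nat \<Rightarrow> nat) \<Rightarrow> (nat \<times> nat) set"
    assume IH: "\<And>y. (y, f) \<in> r \<Longrightarrow>
      (positive (A y) \<and> canonical_on (A y) y) \<and> (\<forall>g. (g, y) \<in> r \<longrightarrow> A y \<subseteq>\<^sup>* A g)"
    have "\<exists>D. positive D \<and> (\<forall>X\<in>A ` {g. (g, f) \<in> r}. D \<subseteq>\<^sup>* X)"
    proof (rule pseudointersection)
      show "countable (A ` {g. (g, f) \<in> r})" using count by simp
      show "positive X" if "X \<in> A ` {g. (g, f) \<in> r}" for X using that IH by blast
      \<comment> \<open>Of two earlier stages, the later was placed almost below the other.\<close>
      show "X \<subseteq>\<^sup>* Y \<or> Y \<subseteq>\<^sup>* X" if "X \<in> A ` {g. (g, f) \<in> r}" "Y \<in> A ` {g. (g, f) \<in> r}" for X Y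
        using that IH tot subset_imp_almost by (metis (no_types, lifting) image_iff mem_Collect_eq order_refl)
    qed
    then obtain D where D: "positive D" "\<And>g. (g, f) \<in> r \<Longrightarrow> D \<subseteq>\<^sup>* A g" by blast
    obtain B where "B \<subseteq> D" "positive B" "canonical_on B f"
      using positive_canonical[OF D(1)] by blast
    then show "\<exists>B. (positive B \<and> canonical_on B f) \<and> (\<forall>g. (g, f) \<in> r \<longrightarrow> B \<subseteq>\<^sup>* A g)"
      using D(2) almost_trans subset_imp_almost by blast
  \<comment> \<open>The goal left is that the requirement at a stage depends on \<open>A\<close>
    only through its values at predecessors.\<close>
  qed auto
  then show ?thesis using tot subset_imp_almost by (metis order_refl)
qed

section \<open>Five unavoidable colours of pairs\<close>

text \<open>Two points in one column get colour 0 or 1 according to whether the sequences they code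
  are comparable under extension; points in distinct columns get colours 2, 3, 4.\<close>

definition pair_colour :: "(nat \<times> nat) set \<Rightarrow> nat" where
  "pair_colour s =
    (if \<exists>n u v. s = {(n, list_encode u), (n, list_encode (u @ v))} then 0
     else if \<exists>n. fst ` s \<subseteq> {n} then 1
     else if \<exists>a b c d. s = {(a, b), (c, d)} \<and> a < c \<and> b \<le> c then 2
     else if \<exists>a b c d. s = {(a, b), (c, d)} \<and> a < c \<and> c < b \<and> b < d then 3
     else 4)"

lemma positive_columns:
  assumes "positive H"
  obtains n where "n > k" "somewhere_dense (H `` {n})"
  using assms unfolding positive_def infinite_nat_iff_unbounded by blast

lemma somewhere_dense_column_unbounded:
  assumes "somewhere_dense (H `` {n})"
  obtains m where "m > k" "(n, m) \<in> H"
  using somewhere_dense_infinite[OF assms] unfolding infinite_nat_iff_unbounded by auto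

text \<open>For \<open>(a, b)\<close> and \<open>(c, d)\<close> with \<open>a < c\<close>, colours
  2, 3 and 4 mean \<open>b \<le> c\<close>, \<open>c < b < d\<close>, and \<open>c < b\<close> with
  \<open>d \<le> b\<close>. All occur because dense columns exist arbitrarily far out and are
  themselves unbounded; colours 0 and 1 come from density inside one column.\<close>

lemma pair_colour_onto:
  assumes pos: "positive H" and "i < 5"
  shows "\<exists>s. s \<subseteq> H \<and> finite s \<and> card s = 2 \<and> pair_colour s = i"
proof -
  obtain a where a: "somewhere_dense (H `` {a})" using positive_columns[OF pos] by blast
  obtain s where s: "\<And>t. \<exists>u. list_encode (s @ t @ u) \<in> H `` {a}"
    using a unfolding somewhere_dense_def by blast
  have *: ?thesis if "x \<in> H" "y \<in> H" "x \<noteq> y" "pair_colour {x, y} = i" for x y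
    using that by (intro exI[of _ "{x, y}"]) auto
  consider "i = 0" | "i = 1" | "i = 2" | "i = 3" | "i = 4" using \<open>i < 5\<close> by linarith
  then show ?thesis
  proof cases
    case 1
    obtain u where u: "list_encode (s @ [] @ u) \<in> H `` {a}" using s by blast
    \<comment> \<open>The appended 0 makes the second sequence a proper extension, so the two points
      differ.\<close>
    obtain v where v: "list_encode (s @ (u @ [0]) @ v) \<in> H `` {a}" using s by blast
    have "pair_colour {(a, list_encode (s @ u)), (a, list_encode ((s @ u) @ ([0] @ v)))} = 0"
      unfolding pair_colour_def by (subst if_P) (blast, rule refl)
    then show ?thesis
      using u v 1 by (intro *[of "(a, list_encode (s @ u))" "(a, list_encode ((s @ u) @ ([0] @ v)))"]) (auto simp: list_encode_eq)
  next
    case 2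
    \<comment> \<open>Branching to 0 and to 1 directly after \<open>s\<close> makes the sequences
      incomparable.\<close>
    obtain u where u: "list_encode (s @ [0] @ u) \<in> H `` {a}" using s by blast
    obtain v where v: "list_encode (s @ [1] @ v) \<in> H `` {a}" using s by blast
    have "pair_colour {(a, list_encode (s @ [0] @ u)), (a, list_encode (s @ [1] @ v))} = 1"
      unfolding pair_colour_def by (auto simp: doubleton_eq_iff list_encode_eq append_eq_append_conv2 Cons_eq_append_conv)
    then show ?thesis
      using u v 2 by (intro *[of "(a, list_encode (s @ [0] @ u))" "(a, list_encode (s @ [1] @ v))"]) (auto simp: list_encode_eq)
  next
    case 3
    obtain b where b: "(a, b) \<in> H" using somewhere_dense_column_unbounded[OF a] by blast
    obtain c where c: "c > max a b" "somewhere_dense (H `` {c})" using positive_columns[OF pos] by blast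
    obtain d where d: "(c, d) \<in> H" using somewhere_dense_column_unbounded[OF c(2)] by blast
    have "pair_colour {(a, b), (c, d)} = 2"
      unfolding pair_colour_def using c(1) by (auto simp: doubleton_eq_iff)
    then show ?thesis using b c d 3 by (intro *[of "(a, b)" "(c, d)"]) auto
  next
    case 4
    \<comment> \<open>Choosing \<open>c\<close>, \<open>b\<close>, \<open>d\<close> in this order
      gives \<open>a < c < b < d\<close>.\<close>
    obtain c where c: "c > a" "somewhere_dense (H `` {c})" using positive_columns[OF pos] by blast
    obtain b where b: "b > c" "(a, b) \<in> H" using somewhere_dense_column_unbounded[OF a] by blast
    obtain d where d: "d > b" "(c, d) \<in> H" using somewhere_dense_column_unbounded[OF c(2)] by blast
    have "pair_colour {(a, b), (c, d)} = 3"
      unfolding pair_colour_def using b(1) c(1) d(1) by (auto simp: doubleton_eq_iff)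
    then show ?thesis using b c d 4 by (intro *[of "(a, b)" "(c, d)"]) auto
  next
    case 5
    \<comment> \<open>Here \<open>b\<close> is chosen last, to exceed both \<open>c\<close> and
      \<open>d\<close>.\<close>
    obtain c where c: "c > a" "somewhere_dense (H `` {c})" using positive_columns[OF pos] by blast
    obtain d where d: "(c, d) \<in> H" using somewhere_dense_column_unbounded[OF c(2)] by blast
    obtain b where b: "b > max c d" "(a, b) \<in> H" using somewhere_dense_column_unbounded[OF a] by blast
    have "pair_colour {(a, b), (c, d)} = 4"
      unfolding pair_colour_def using b(1) c(1) by (auto simp: doubleton_eq_iff)
    then show ?thesis using b c d 5 by (intro *[of "(a, b)" "(c, d)"]) auto
  qed
qed

lemma not_weakly_Ramsey_2_4:
  assumes "\<And>H. H \<in> W \<Longrightarrow> positive H"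
  shows "\<not> weakly_Ramsey 2 4 W"
proof
  assume "weakly_Ramsey 2 4 W"
  moreover have lt: "pair_colour s < 5" for s by (simp add: pair_colour_def)
  ultimately obtain H where H: "H \<in> W"
      "card (pair_colour ` {s. s \<subseteq> H \<and> finite s \<and> card s = 2}) \<le> 4"
    unfolding weakly_Ramsey_def by meson
  have "pair_colour ` {s. s \<subseteq> H \<and> finite s \<and> card s = 2} = {..<5}"
  proof (intro equalityI subsetI)
    fix i assume "i \<in> {..<5::nat}"
    then obtain s where "s \<subseteq> H \<and> finite s \<and> card s = 2" "pair_colour s = i"
      using pair_colour_onto[OF assms[OF H(1)]] by blast
    then show "i \<in> pair_colour ` {s. s \<subseteq> H \<and> finite s \<and> card s = 2}" by blast
  qed (use lt in auto)
  with H(2) show False by simp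
qed

section \<open>The ultrafilter generated by the tower\<close>

text \<open>Two values are too few for injectivity on an infinite set, and too few for an injective
  function of the column on infinitely many columns. Only constancy remains, so the tower decides
  every \<open>X\<close>.\<close>

lemma canonical_indicator:
  assumes "positive A" "canonical_on A (\<lambda>x. if x \<in> X then 1 else 0)"
  shows "A \<subseteq> X \<or> A \<subseteq> - X"
proof -
  let ?f = "\<lambda>x. if x \<in> X then 1 else 0 :: nat"
  obtain n where n: "somewhere_dense (A `` {n})" using positive_columns[OF assms(1)] by blast
  have "\<not> inj_on ?f A"
  proof
    assume "inj_on ?f A"
    moreover have "?f ` A \<subseteq> {0, 1}" by auto
    ultimately have "finite A" by (rule inj_on_finite) simp
    then have "finite (A `` {n})" by (simp add: finite_Image)
    then show False using somewhere_dense_infinite[OF n] by blast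
  qed
  moreover have False if g: "inj g" "\<forall>x\<in>A. ?f x = g (fst x)" for g :: "nat \<Rightarrow> nat"
  proof -
    have "g ` {n. somewhere_dense (A `` {n})} \<subseteq> {0, 1}"
    proof (rule image_subsetI)
      fix k assume "k \<in> {n. somewhere_dense (A `` {n})}"
      then have k: "somewhere_dense (A `` {k})" by simp
      obtain m where "(k, m) \<in> A" using somewhere_dense_column_unbounded[OF k] by blast
      then have "?f (k, m) = g k" using g(2) by fastforce
      then show "g k \<in> {0, 1}" by (auto split: if_splits)
    qed
    then have "finite {n. somewhere_dense (A `` {n})}"
      using inj_on_finite[OF inj_on_subset[OF g(1) subset_UNIV]] by simp
    then show False using assms(1) by (simp add: positive_def)
  qed
  ultimately obtain c where "\<forall>x\<in>A. ?f x = c" using assms(2) unfolding canonical_on_def by blast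
  then show ?thesis by (cases "c = 1") (auto split: if_splits)
qed

theorem mainTheorem7:
  assumes "CH"
  shows "\<exists>W. non_P_point_standard W \<and> three_functions_property W \<and> \<not> weakly_Ramsey 2 4 W"
proof -
  obtain A :: "(nat \<times> nat \<Rightarrow> nat) \<Rightarrow> (nat \<times> nat) set"
    where pos: "\<And>f. positive (A f)" and canon: "\<And>f. canonical_on (A f) f"
      and chain: "\<And>f g. A f \<subseteq>\<^sup>* A g \<or> A g \<subseteq>\<^sup>* A f"
    using CH_tower[OF assms] by blast
  \<comment> \<open>Closing the tower upwards under \<open>\<subseteq>\<^sup>*\<close> keeps every
    member positive; comparability of the generators gives closure under intersection.\<close>
  define W where "W = {X. \<exists>f. A f \<subseteq>\<^sup>* X}"
  have AW: "A f \<in> W" for f using subset_imp_almost[of "A f" "A f"] by (auto simp: W_def)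
  have posW: "positive H" if "H \<in> W" for H
    using that pos positive_almost unfolding W_def by blast
  have up: "Y \<in> W" if "X \<in> W" "X \<subseteq> Y" for X Y
    using that almost_trans subset_imp_almost unfolding W_def by blast
  have Int: "X \<inter> Y \<in> W" if "X \<in> W" "Y \<in> W" for X Y
  proof -
    obtain f g where "A f \<subseteq>\<^sup>* X" "A g \<subseteq>\<^sup>* Y" using \<open>X \<in> W\<close> \<open>Y \<in> W\<close> by (auto simp: W_def)
    then show ?thesis using chain[of f g] almost_trans almost_Int unfolding W_def by blast
  qed
  have "X \<in> W \<or> - X \<in> W" for X
  proof -
    let ?f = "\<lambda>x. if x \<in> X then 1 else 0 :: nat"
    \<comment> \<open>The indicator of \<open>X\<close> is itself one of the stages of the
      tower.\<close>
    have "A ?f \<subseteq> X \<or> A ?f \<subseteq> - X"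
      using canonical_indicator[of "A ?f" X] pos[of ?f] canon[of ?f] by blast
    then show ?thesis using AW[of ?f] up by blast
  qed
  moreover have "{} \<notin> W" using posW[of "{}"] by (auto simp: positive_def somewhere_dense_def)
  ultimately have "ultrafilter_on_sq W"
    unfolding ultrafilter_on_sq_def using up Int AW by (metis subset_UNIV)
  moreover have col: "infinite {x\<in>H. fst x = n}" if "somewhere_dense (H `` {n})" for H n
  proof
    assume "finite {x\<in>H. fst x = n}"
    then have "finite (snd ` {x\<in>H. fst x = n})" by simp
    moreover have "snd ` {x\<in>H. fst x = n} = H `` {n}" by force
    ultimately show False using somewhere_dense_infinite[OF that] by simp
  qed
  \<comment> \<open>Two distinct somewhere dense columns suffice: one is infinite, so the projection
    is not finite-to-one, and both are nonempty, so it is not constant.\<close>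
  have "\<not> (\<forall>n. finite {x\<in>H. fst x = n})" "infinite H" "\<not> (\<exists>n. \<forall>x\<in>H. fst x = n)" if H: "H \<in> W" for H
  proof -
    obtain n where n: "somewhere_dense (H `` {n})" using positive_columns[OF posW[OF H]] by blast
    obtain k where k: "k > n" "somewhere_dense (H `` {k})" using positive_columns[OF posW[OF H]] by blast
    show "\<not> (\<forall>n. finite {x\<in>H. fst x = n})" using col[OF n] by blast
    then show "infinite H" by auto
    obtain m l where "(n, m) \<in> H" "(k, l) \<in> H"
      using somewhere_dense_column_unbounded[OF n] somewhere_dense_column_unbounded[OF k(2)] by metis
    then show "\<not> (\<exists>n. \<forall>x\<in>H. fst x = n)" using k(1) by (metis fst_conv less_irrefl)
  qed
  ultimately have "non_P_point_standard W"
    unfolding non_P_point_standard_def nonprincipal_def by blast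
  moreover have "three_functions_property W"
    unfolding three_functions_property_def
  proof
    fix f
    show "\<exists>H\<in>W. (\<exists>c. \<forall>x\<in>H. f x = c) \<or> inj_on f H \<or>
        (\<exists>g :: nat \<Rightarrow> nat. inj g \<and> (\<forall>x\<in>H. f x = g (fst x)))"
      using canon[of f, unfolded canonical_on_def] by (rule bexI[OF _ AW])
  qed
  moreover have "\<not> weakly_Ramsey 2 4 W" using posW by (rule not_weakly_Ramsey_2_4)
  ultimately show ?thesis by blast
qed

end
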